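(* Let $\mathscr{A}\subset k[\boldsymbol{x}^{\pm1}]$ be the $k$-subalgebra constructed in the context from the data $C, C_1,\dots,C_r, R, I,\phi_1,\dots,\phi_r,U$. Then the $k$-algebra $\mathscr{A}$ is finitely generated.
   Context: Let $k$ be a field, $n\ge1$, and $k[\boldsymbol{x}^{\pm1}]=k[x_1,\dots,x_n,x_1^{-1},\dots,x_n^{-1}]$. For $\mathbf a=(a_1,\dots,a_n)\in\mathbb{Z}^n$ write $\boldsymbol{x}^{\mathbf a}=x_1^{a_1}\cdots x_n^{a_n}$. For $f=\sum_{\mathbf a}u_{\mathbf a}\boldsymbol{x}^{\mathbf a}$ with $u_{\mathbf a}\in k$, set $\operatorname{supp} f=\{\mathbf a\mid u_{\mathbf a}\neq0\}$; for $V\subset k[\boldsymbol{x}^{\pm1}]$ set $\operatorname{supp}V=\bigcup_{f\in V\setminus\{0\}}\operatorname{supp}f$. A convex cone in $\mathbb{R}^n$ is a nonempty subset $C$ with $\alpha\mathbf a+\beta\mathbf b\in C$ for all $\alpha,\beta\ge0$, $\mathbf a,\mathbf b\in C$. A subset $F\subset C$ is a face of $C$ if there is $\omega\in\mathbb{R}^n$ (a normal vector of $F$) with $F=\{\mathbf a\in C\mid\omega\cdot\mathbf a=0\}$ and $\omega\cdot\mathbf a\ge0$ for all $\mathbf a\in C$ (standard inner product). Construction. Let $C\subset\mathbb{R}^n$ be a convex cone and $C_1,\dots,C_r$ ($r\ge2$) faces of $C$ such that $C_i\not\subset C_j$ whenever $i\ne j$. Put $C^{\circ}=C\setminus\bigcup_{i=1}^rC_i$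 and $C_i^{\circ}=C_i\setminus\bigcup_{j\ne i}C_j$. Let: - $R$ be a finitely generated $k$-domain (a $k$-algebra that is an integral domain) and $I\neq\{0\}$ an ideal of $R$ with $R=k+I$; - $\phi_1,\dots,\phi_r:R\to k[\boldsymbol{x}^{\pm1}]$ be injective homomorphisms of $k$-algebras with $\operatorname{supp}\phi_i(I)\subset C_i^{\circ}$ for $i=1,\dots,r$; - $U\subset k[\boldsymbol{x}^{\pm1}]$ be a finite (possibly empty) subset with $\operatorname{supp}U\subset C^{\circ}$. Let $\mathscr{B}=k[\phi_1(I)\cup\dots\cup\phi_r(I)\cup U]$ and let $J$ be the ideal of $\mathscr{B}$ generated by $\bigcup_{1\le i_1<i_2\le r}\phi_{i_1}(I)\phi_{i_2}(I)\cup U$. Let $\phi=\phi_1+\dots+\phi_r:R\to k[\boldsymbol{x}^{\pm1}]$ (a $k$-linear map). Choose $r_1,\dots,r_N\in I\setminus\{0\}$ ($N\ge1$) with $R=k[r_1,\dots,r_N]$, and define $\mathscr{A}=k[\phi(r_1),\dots,\phi(r_N)]+J$. This is a $k$-subalgebra of $k[\boldsymbol{x}^{\pm1}]$ equal to $k+\phi(I)+J$, hence independent of the choice of $r_1,\dots,r_N$. *)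

theory Defs
  imports "HOL-Analysis.Analysis" "HOL-Library.Poly_Mapping" "HOL-Library.Set_Algebras"
begin

section \<open>Commutative algebras over a field\<close>

locale k_algebra = vector_space smul
  for smul :: "'k::field \<Rightarrow> 'r::comm_ring_1 \<Rightarrow> 'r" +
  assumes smul_mult_left: "smul c (x * y) = smul c x * y"

definition is_subalgebra :: "('k::field \<Rightarrow> 'r::comm_ring_1 \<Rightarrow> 'r) \<Rightarrow> 'r set \<Rightarrow> bool" where
  "is_subalgebra smul A \<longleftrightarrow>
     module.subspace smul A \<and> 1 \<in> A \<and> (\<forall>x\<in>A. \<forall>y\<in>A. x * y \<in> A)"

text \<open>\<open>adjoin smul X\<close> is the subalgebra \<open>k[X]\<close>.\<close>

definition adjoin :: "('k::field \<Rightarrow> 'r::comm_ring_1 \<Rightarrow> 'r) \<Rightarrow> 'r set \<Rightarrow> 'r set" where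
  "adjoin smul X = is_subalgebra smul hull X"

text \<open>A finitely generated set is in particular a subalgebra of the ambient algebra.\<close>

definition finitely_generated :: "('k::field \<Rightarrow> 'r::comm_ring_1 \<Rightarrow> 'r) \<Rightarrow> 'r set \<Rightarrow> bool" where
  "finitely_generated smul A \<longleftrightarrow> (\<exists>S. finite S \<and> A = adjoin smul S)"

definition algebra_hom ::
  "('k::field \<Rightarrow> 'r::comm_ring_1 \<Rightarrow> 'r) \<Rightarrow> ('k \<Rightarrow> 's::comm_ring_1 \<Rightarrow> 's) \<Rightarrow> ('r \<Rightarrow> 's) \<Rightarrow> bool" where
  "algebra_hom s1 s2 f \<longleftrightarrow>
     Vector_Spaces.linear s1 s2 f \<and> f 1 = 1 \<and> (\<forall>x y. f (x * y) = f x * f y)"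

text \<open>
  \<open>is_ideal B J\<close> is meant for a subring \<open>B\<close>. Closure of \<open>J\<close> under negation follows
  from \<open>-1 \<in> B\<close>.
\<close>

definition is_ideal :: "'r::comm_ring_1 set \<Rightarrow> 'r set \<Rightarrow> bool" where
  "is_ideal B J \<longleftrightarrow>
     J \<subseteq> B \<and> 0 \<in> J \<and> (\<forall>x\<in>J. \<forall>y\<in>J. x + y \<in> J) \<and> (\<forall>b\<in>B. \<forall>x\<in>J. b * x \<in> J)"

definition ideal_generated :: "'r::comm_ring_1 set \<Rightarrow> 'r set \<Rightarrow> 'r set" where
  "ideal_generated B X = is_ideal B hull X"


section \<open>Laurent polynomials\<close>

text \<open>
  The Laurent polynomial ring in variables indexed by \<open>'n\<close> is the monoid algebra of
  \<open>\<int>\<^sup>n\<close>: finitely supported functions from exponent vectors to coefficients, with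
  convolution as multiplication.
\<close>

type_synonym ('k, 'n) laurent = "(int, 'n) vec \<Rightarrow>\<^sub>0 'k"

definition laurent_scale :: "'k::field \<Rightarrow> ('k, 'n::finite) laurent \<Rightarrow> ('k, 'n) laurent" where
  "laurent_scale c f = Poly_Mapping.single 0 c * f"

lemma lookup_laurent_scale:
  "Poly_Mapping.lookup (laurent_scale c f) a = c * Poly_Mapping.lookup f a"
  unfolding laurent_scale_def mult_map_scale_conv_mult[symmetric]
  by (simp add: Poly_Mapping.map.rep_eq when_def)

interpretation laurent: k_algebra laurent_scale
  by unfold_locales
    (simp_all add: laurent_scale_def algebra_simps single_add mult_single flip: mult.assoc)

definition supp_set :: "('k::zero, 'n) laurent set \<Rightarrow> (int ^ 'n) set" where
  "supp_set V = (\<Union>f\<in>V - {0}. Poly_Mapping.keys f)"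

definition real_vec :: "int ^ 'n \<Rightarrow> real ^ 'n" where
  "real_vec a = (\<chi> i. real_of_int (a $ i))"


section \<open>Faces of convex cones\<close>

text \<open>
  This differs from \<^const>\<open>face_of\<close> and \<^const>\<open>exposed_face_of\<close>: the
  supporting hyperplane is required to pass through the origin.
\<close>

definition cone_face :: "(real ^ 'n) set \<Rightarrow> (real ^ 'n) set \<Rightarrow> bool" where
  "cone_face C F \<longleftrightarrow>
     (\<exists>\<omega>. F = {a \<in> C. \<omega> \<bullet> a = 0} \<and> (\<forall>a\<in>C. \<omega> \<bullet> a \<ge> 0))"

text \<open>
  \<open>C\<^sup>\<circ>\<close> and \<open>C\<^sub>i\<^sup>\<circ>\<close>. These are not topological interiors: only the given faces \<open>F 1, \<dots>, F r\<close>
  are removed.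
\<close>

definition cone_interior :: "nat \<Rightarrow> (real ^ 'n) set \<Rightarrow> (nat \<Rightarrow> (real ^ 'n) set) \<Rightarrow> (real ^ 'n) set" where
  "cone_interior r C F = C - (\<Union>i\<in>{1..r}. F i)"

definition face_interior :: "nat \<Rightarrow> (nat \<Rightarrow> (real ^ 'n) set) \<Rightarrow> nat \<Rightarrow> (real ^ 'n) set" where
  "face_interior r F i = F i - (\<Union>j\<in>{1..r} - {i}. F j)"


section \<open>The construction\<close>

definition algebra_B ::
  "nat \<Rightarrow> 'r set \<Rightarrow> (nat \<Rightarrow> 'r \<Rightarrow> ('k::field, 'n::finite) laurent)
    \<Rightarrow> ('k, 'n) laurent set \<Rightarrow> ('k, 'n) laurent set" where
  "algebra_B r I \<phi> U = adjoin laurent_scale ((\<Union>i\<in>{1..r}. \<phi> i ` I) \<union> U)"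

text \<open>In \<open>ideal_J\<close>, \<open>*\<close> is the elementwise product of sets from \<^theory>\<open>HOL-Library.Set_Algebras\<close>.\<close>

definition ideal_J ::
  "nat \<Rightarrow> 'r set \<Rightarrow> (nat \<Rightarrow> 'r \<Rightarrow> ('k::field, 'n::finite) laurent)
    \<Rightarrow> ('k, 'n) laurent set \<Rightarrow> ('k, 'n) laurent set" where
  "ideal_J r I \<phi> U = ideal_generated (algebra_B r I \<phi> U)
     ((\<Union>(i, j) \<in> {(i, j). 1 \<le> i \<and> i < j \<and> j \<le> r}. (\<phi> i ` I) * (\<phi> j ` I)) \<union> U)"

text \<open>Here \<open>+\<close> is the elementwise sum of sets, and \<open>\<rho> 1, \<dots>, \<rho> N\<close> are the chosen generators of \<open>R\<close>.\<close>

definition algebra_A ::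
  "nat \<Rightarrow> 'r set \<Rightarrow> (nat \<Rightarrow> 'r \<Rightarrow> ('k::field, 'n::finite) laurent)
    \<Rightarrow> ('k, 'n) laurent set \<Rightarrow> nat \<Rightarrow> (nat \<Rightarrow> 'r) \<Rightarrow> ('k, 'n) laurent set" where
  "algebra_A r I \<phi> U N \<rho> =
     adjoin laurent_scale ((\<lambda>l. \<Sum>i=1..r. \<phi> i (\<rho> l)) ` {1..N}) + ideal_J r I \<phi> U"

end

theory Submission
  imports Defs
begin

text \<open>
  For \<open>a \<in> I\<close> the element \<open>x = \<phi>\<^sub>i a\<close> satisfies \<open>x\<^sup>2 = \<phi>(a) x - \<Sum>\<^sub>j\<^sub>\<noteq>\<^sub>i x \<phi>\<^sub>j(a)\<close>, a monic equation over \<open>A\<close>.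
  So \<open>B\<close> is integral over \<open>A\<close>, and as a module over a finitely generated subalgebra of \<open>A\<close> it is
  spanned by the squarefree monomials in the finitely many generators \<open>\<phi>\<^sub>i(\<rho>\<^sub>l)\<close> and \<open>U\<close>. The
  ideal \<open>J\<close> of \<open>B\<close> has an explicit finite generating set, because \<open>I\<close> is the ideal generated by the
  \<open>\<rho>\<^sub>l\<close>. The products of squarefree monomials with generators of \<open>J\<close> thus generate \<open>J\<close> over that
  subalgebra, and no Noetherian argument is needed.
\<close>

section \<open>Subalgebras and ideals of a commutative algebra\<close>

lemma (in k_algebra) is_subalgebraI:
  assumes "\<And>c. smul c 1 \<in> A"
    and "\<And>x y. x \<in> A \<Longrightarrow> y \<in> A \<Longrightarrow> x + y \<in> A"
    and "\<And>x y. x \<in> A \<Longrightarrow> y \<in> A \<Longrightarrow> x * y \<in> A"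
  shows "is_subalgebra smul A"
proof -
  have "1 \<in> A" "0 \<in> A"
    using assms(1)[of 1] assms(1)[of 0] by simp_all
  moreover have "smul c x \<in> A" if "x \<in> A" for c x
    using assms(3)[OF assms(1) that, of c] smul_mult_left[of c 1 x] by simp
  ultimately show ?thesis
    using assms unfolding is_subalgebra_def by (auto intro!: subspaceI)
qed

context k_algebra
begin

context
  fixes A assumes A: "is_subalgebra smul A"
begin

lemma subalgebra_1: "1 \<in> A"
  and subalgebra_mult: "x \<in> A \<Longrightarrow> y \<in> A \<Longrightarrow> x * y \<in> A"
  and subalgebra_0: "0 \<in> A"
  and subalgebra_add: "x \<in> A \<Longrightarrow> y \<in> A \<Longrightarrow> x + y \<in> A"
  and subalgebra_uminus: "x \<in> A \<Longrightarrow> - x \<in> A"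
  and subalgebra_scale: "x \<in> A \<Longrightarrow> smul c x \<in> A"
  and subalgebra_sum: "(\<And>i. i \<in> T \<Longrightarrow> f i \<in> A) \<Longrightarrow> sum f T \<in> A"
  using A by (simp_all add: is_subalgebra_def subspace_0 subspace_add subspace_neg
      subspace_scale subspace_sum)

lemma subalgebra_prod: "(\<And>i. i \<in> T \<Longrightarrow> f i \<in> A) \<Longrightarrow> prod f T \<in> A"
  by (induction T rule: infinite_finite_induct) (auto intro: subalgebra_1 subalgebra_mult)

lemma is_ideal_self: "is_ideal A A"
  unfolding is_ideal_def using subalgebra_0 subalgebra_add subalgebra_mult by blast

lemma adjoin_minimal: "X \<subseteq> A \<Longrightarrow> adjoin smul X \<subseteq> A"
  unfolding adjoin_def using A by (rule hull_minimal[rotated])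

end

lemma is_subalgebra_adjoin: "is_subalgebra smul (adjoin smul X)"
proof -
  have "is_subalgebra smul (\<Inter>T)" if "\<forall>A\<in>T. is_subalgebra smul A" for T
    using that by (intro is_subalgebraI)
      (simp_all add: subalgebra_1 subalgebra_add subalgebra_mult subalgebra_scale)
  then show ?thesis
    unfolding adjoin_def by (simp add: hull_in)
qed

lemma adjoin_inc: "x \<in> X \<Longrightarrow> x \<in> adjoin smul X"
  unfolding adjoin_def by (rule hull_inc)

end

lemma ideal_generated_inc: "x \<in> X \<Longrightarrow> x \<in> ideal_generated B X"
  unfolding ideal_generated_def by (rule hull_inc)

lemma ideal_generated_minimal: "X \<subseteq> J \<Longrightarrow> is_ideal B J \<Longrightarrow> ideal_generated B X \<subseteq> J"
  unfolding ideal_generated_def by (rule hull_minimal)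

text \<open>Ideals are stable under intersection, but \<open>is_ideal B\<close> also demands
  containment in \<open>B\<close>. The hypotheses make \<open>B\<close> itself a member of the
  intersected family, which bounds the hull.\<close>

lemma is_ideal_ideal_generated:
  assumes "is_ideal B B" "X \<subseteq> B"
  shows "is_ideal B (ideal_generated B X)"
proof -
  have "ideal_generated B X \<subseteq> B"
    using assms by (simp add: ideal_generated_minimal)
  then show ?thesis
    unfolding ideal_generated_def hull_def by (auto simp: is_ideal_def)
qed

lemma is_ideal_sum:
  assumes "is_ideal B J" "\<And>i. i \<in> T \<Longrightarrow> f i \<in> J"
  shows "sum f T \<in> J"
  using assms(2) by (induction T rule: infinite_finite_induct) (use assms(1) in \<open>auto simp: is_ideal_def\<close>)

text \<open>In a product of two sums, every term except the product of the two
  \<open>S\<close>-parts has a factor in \<open>J\<close> and a factor in \<open>B\<close>, so it is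
  absorbed by \<open>J\<close>.\<close>

lemma (in k_algebra) is_subalgebra_plus_ideal:
  assumes S: "is_subalgebra smul S" and J: "is_ideal B J" and "S \<subseteq> B"
  shows "is_subalgebra smul (S + J)"
proof (rule is_subalgebraI)
  fix c show "smul c 1 \<in> S + J"
    using set_plus_intro[OF subalgebra_scale[OF S subalgebra_1[OF S]], of 0 J c] J
    by (simp add: is_ideal_def)
next
  fix x y assume "x \<in> S + J" "y \<in> S + J"
  then obtain s i t j where xy: "x = s + i" "y = t + j" and st: "s \<in> S" "t \<in> S" and ij: "i \<in> J" "j \<in> J"
    by (auto elim!: set_plus_elim)
  have "x + y = (s + t) + (i + j)" "i + j \<in> J"
    using J ij unfolding xy by (auto simp: is_ideal_def)
  then show "x + y \<in> S + J"
    using subalgebra_add[OF S st] by (metis set_plus_intro)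
  have "s \<in> B" "t \<in> B" "i \<in> B" using st ij J \<open>S \<subseteq> B\<close> by (auto simp: is_ideal_def)
  then have "s * j + (t * i + i * j) \<in> J"
    using J ij by (simp add: is_ideal_def)
  moreover have "x * y = s * t + (s * j + (t * i + i * j))"
    unfolding xy by (simp add: algebra_simps)
  ultimately show "x * y \<in> S + J"
    using subalgebra_mult[OF S st] by (metis set_plus_intro)
qed

section \<open>Finite generation from monic quadratic relations\<close>

text \<open>The relations lower repeated factors in a monomial until it is a
  \<open>T\<close>-combination of squarefree ones. The factor \<open>g\<close>, not assumed to lie
  in \<open>T\<close>, lets the result apply to generators of an ideal.\<close>

lemma (in k_algebra) adjoin_quadratic_mult_mem:
  assumes T: "is_subalgebra smul T" and "finite X"
    and quadratic: "\<And>x. x \<in> X \<Longrightarrow> \<exists>s\<in>T. \<exists>t\<in>T. x * x = s * x + t"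
    and squarefree: "\<And>Y. Y \<subseteq> X \<Longrightarrow> \<Prod>Y * g \<in> T"
    and b: "b \<in> adjoin smul X"
  shows "b * g \<in> T"
proof -
  \<comment> \<open>Closure of \<open>L\<close> under products is not evident, so the induction over
    \<open>adjoin smul X\<close> runs through its stabilizer \<open>M\<close>, where products are
    compositions.\<close>
  define L where "L = {b. \<forall>Y\<subseteq>X. b * (\<Prod>Y * g) \<in> T}"
  define M where "M = {y. \<forall>b\<in>L. y * b \<in> L}"
  have "is_subalgebra smul M"
  proof (rule is_subalgebraI)
    fix c show "smul c 1 \<in> M"
      by (auto simp: M_def L_def simp flip: smul_mult_left intro: subalgebra_scale[OF T])
  next
    fix x y assume "x \<in> M" "y \<in> M"
    then show "x + y \<in> M"
      by (auto simp: M_def L_def distrib_right intro: subalgebra_add[OF T])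
    show "x * y \<in> M"
      using \<open>x \<in> M\<close> \<open>y \<in> M\<close> by (simp add: M_def mult.assoc)
  qed
  moreover have "X \<subseteq> M"
  proof
    fix x assume x: "x \<in> X"
    have "x * b * (\<Prod>Y * g) \<in> T" if b: "b \<in> L" and Y: "Y \<subseteq> X" for b Y
    proof (cases "x \<in> Y")
      case False
      then have "x * b * (\<Prod>Y * g) = b * (\<Prod>(insert x Y) * g)"
        using finite_subset[OF Y \<open>finite X\<close>] by (simp add: mult_ac)
      then show ?thesis
        using b x Y by (simp add: L_def)
    next
      case True
      obtain s t where st: "s \<in> T" "t \<in> T" "x * x = s * x + t"
        using quadratic x by blast
      define Z where "Z = Y - {x}"
      have "Z \<subseteq> X"
        using Y by (auto simp: Z_def)
      have Z: "\<Prod>Y = x * \<Prod>Z"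
        using True finite_subset[OF Y \<open>finite X\<close>] by (simp add: Z_def prod.remove)
      \<comment> \<open>The repeated factor \<open>x\<close> is isolated as a square. After
        reduction, one term has the old squarefree product and the other has \<open>x\<close>
        removed.\<close>
      have "x * b * (\<Prod>Y * g) = (x * x) * (b * (\<Prod>Z * g))"
        unfolding Z by (simp add: mult_ac)
      also have "\<dots> = s * (b * (\<Prod>Y * g)) + t * (b * (\<Prod>Z * g))"
        unfolding Z st by (simp add: algebra_simps)
      also have "\<dots> \<in> T"
      proof -
        have "b * (\<Prod>Y * g) \<in> T" "b * (\<Prod>Z * g) \<in> T"
          using b Y \<open>Z \<subseteq> X\<close> by (auto simp: L_def)
        then show ?thesis
          using st(1,2) by (simp add: subalgebra_add[OF T] subalgebra_mult[OF T])
      qed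
      finally show ?thesis .
    qed
    then show "x \<in> M"
      by (simp add: M_def L_def)
  qed
  ultimately have "b \<in> M"
    using adjoin_minimal b by blast
  moreover have "1 \<in> L"
    using squarefree by (simp add: L_def)
  ultimately have "b \<in> L"
    by (force simp: M_def)
  then show ?thesis
    \<comment> \<open>The instance \<open>Y = {}\<close> of membership in \<open>L\<close>.\<close>
    using L_def by force
qed

text \<open>Enlarging \<open>S\<close> by the coefficients of the relations and by the squarefree
  multiples of \<open>G\<close> stays inside \<open>A\<close>, and the enlarged finite set already
  generates the whole ideal part.\<close>

lemma (in k_algebra) finitely_generated_adjoin_plus_ideal:
  assumes "finite X" "finite S" "finite G"
    and S: "S \<subseteq> adjoin smul X" and G: "G \<subseteq> adjoin smul X"
  defines "A \<equiv> adjoin smul S + ideal_generated (adjoin smul X) G"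
  assumes quadratic: "\<And>x. x \<in> X \<Longrightarrow> \<exists>s\<in>A. \<exists>t\<in>A. x * x = s * x + t"
  shows "finitely_generated smul A"
proof -
  define B where "B = adjoin smul X"
  define J where "J = ideal_generated B G"
  have B: "is_subalgebra smul B"
    unfolding B_def by (rule is_subalgebra_adjoin)
  have J: "is_ideal B J"
    unfolding J_def using is_ideal_self[OF B] G by (simp add: B_def is_ideal_ideal_generated)
  have A_eq: "A = adjoin smul S + J"
    by (simp add: A_def J_def B_def)
  have A: "is_subalgebra smul A"
    unfolding A_eq using S
    by (intro is_subalgebra_plus_ideal[OF _ J] is_subalgebra_adjoin) (simp add: B_def adjoin_minimal is_subalgebra_adjoin)
  have SA: "adjoin smul S \<subseteq> A" and JA: "J \<subseteq> A"
    unfolding A_eq using set_zero_plus2[of J "adjoin smul S"] J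
      set_zero_plus2[OF subalgebra_0[OF is_subalgebra_adjoin], of J S]
    by (simp_all add: add.commute is_ideal_def)
  obtain s t where st: "\<And>x. x \<in> X \<Longrightarrow> s x \<in> A \<and> t x \<in> A \<and> x * x = s x * x + t x"
    using quadratic by metis
  \<comment> \<open>Including the finitely many coefficients \<open>s x\<close> and
    \<open>t x\<close> makes the quadratic relations hold over \<open>T\<close>, not merely over
    \<open>A\<close>.\<close>
  define S' where "S' = S \<union> s ` X \<union> t ` X \<union> (\<lambda>(Y, g). \<Prod>Y * g) ` (Pow X \<times> G)"
  define T where "T = adjoin smul S'"
  have T: "is_subalgebra smul T"
    unfolding T_def by (rule is_subalgebra_adjoin)
  have inc: "x \<in> T" if "x \<in> S'" for x
    unfolding T_def using that by (rule adjoin_inc)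
  have "T \<subseteq> A"
    unfolding T_def
  proof (rule adjoin_minimal[OF A])
    have "\<Prod>Y * g \<in> J" if "Y \<subseteq> X" "g \<in> G" for Y g
    proof -
      have "\<Prod>Y \<in> B"
        by (rule subalgebra_prod[OF B]) (use that(1) in \<open>auto simp: B_def intro: adjoin_inc\<close>)
      then show ?thesis
        using J ideal_generated_inc[OF that(2), of B] by (simp add: is_ideal_def J_def)
    qed
    then show "S' \<subseteq> A"
      using st SA JA adjoin_inc[of _ S] by (auto simp: S'_def)
  qed
  moreover have "A \<subseteq> T"
  proof -
    have "adjoin smul S \<subseteq> T"
      by (rule adjoin_minimal[OF T]) (auto simp: S'_def intro!: inc)
    moreover have "J \<subseteq> T"
    proof -
      have "b * g \<in> T" if "b \<in> B" "g \<in> G" for b g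
        using T \<open>finite X\<close> _ _ that(1)[unfolded B_def]
      proof (rule adjoin_quadratic_mult_mem)
        fix x assume "x \<in> X"
        then show "\<exists>s\<in>T. \<exists>t\<in>T. x * x = s * x + t"
          using st by (intro bexI[of _ "s x"] bexI[of _ "t x"] inc) (auto simp: S'_def)
      qed (use that(2) in \<open>auto simp: S'_def intro!: inc\<close>)
      \<comment> \<open>The elements of \<open>B\<close> all of whose \<open>B\<close>-multiples lie
        in \<open>T\<close> form an ideal of \<open>B\<close>, so only the generators
        \<open>G\<close> need checking. The multiplier 1 then gives
        \<open>J \<subseteq> T\<close>.\<close>
      moreover have "is_ideal B {j \<in> B. \<forall>b\<in>B. b * j \<in> T}"
        using subalgebra_0[OF T] subalgebra_0[OF B]
        by (auto simp: is_ideal_def distrib_left subalgebra_add[OF T] subalgebra_add[OF B]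
            subalgebra_mult[OF B] simp flip: mult.assoc)
      ultimately have "J \<subseteq> {j \<in> B. \<forall>b\<in>B. b * j \<in> T}"
        unfolding J_def using G by (intro ideal_generated_minimal) (auto simp: B_def)
      then show ?thesis
        using subalgebra_1[OF B] by force
    qed
    ultimately show ?thesis
      unfolding A_eq by (auto elim!: set_plus_elim intro: subalgebra_add[OF T])
  qed
  ultimately have "A = adjoin smul S'"
    unfolding T_def by blast
  moreover have "finite S'"
    using assms(1-3) by (simp add: S'_def)
  ultimately show ?thesis
    unfolding finitely_generated_def by blast
qed

section \<open>Generators of a proper ideal\<close>

text \<open>Fails for \<open>I = R = k[x]\<close> and \<open>X = {x}\<close>, hence the assumption that \<open>I\<close> is proper.\<close>

lemma (in k_algebra) proper_ideal_eq_ideal_generated: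
  assumes I: "is_ideal UNIV I" and "1 \<notin> I" and "X \<subseteq> I" and gen: "adjoin smul X = UNIV"
  shows "I = ideal_generated UNIV X"
proof
  define I' where "I' = ideal_generated UNIV X"
  show "I' \<subseteq> I"
    unfolding I'_def using I \<open>X \<subseteq> I\<close> by (simp add: ideal_generated_minimal)
  have I': "is_ideal UNIV I'"
    unfolding I'_def by (rule is_ideal_ideal_generated) (auto simp: is_ideal_def)
  \<comment> \<open>Scalars plus \<open>I'\<close> form a subalgebra containing the algebra
    generators \<open>X\<close>, hence everything.\<close>
  have "is_subalgebra smul (range (\<lambda>c. smul c 1) + I')"
    by (rule is_subalgebra_plus_ideal[OF _ I'], rule is_subalgebraI)
      (auto simp flip: scale_left_distrib smul_mult_left)
  moreover have "X \<subseteq> range (\<lambda>c. smul c 1) + I'"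
  proof -
    have "smul 0 1 \<in> range (\<lambda>c. smul c 1)"
      by (rule rangeI)
    then have "I' \<subseteq> range (\<lambda>c. smul c 1) + I'"
      by (simp add: set_zero_plus2)
    then show ?thesis
      using ideal_generated_inc[of _ X UNIV] by (auto simp: I'_def)
  qed
  ultimately have all: "range (\<lambda>c. smul c 1) + I' = UNIV"
    using adjoin_minimal gen by blast
  show "I \<subseteq> I'"
  proof
    fix a assume "a \<in> I"
    obtain c i where ci: "a = smul c 1 + i" "i \<in> I'"
      using UNIV_I[of a] unfolding all[symmetric] by (auto elim!: set_plus_elim)
    have "- 1 * i \<in> I"
      using I ci(2) \<open>I' \<subseteq> I\<close> unfolding is_ideal_def by blast
    then have "a + - 1 * i \<in> I"
      using I \<open>a \<in> I\<close> unfolding is_ideal_def by blast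
    then have "smul c 1 \<in> I"
      using ci by simp
    \<comment> \<open>A nonzero scalar part would be a unit in \<open>I\<close>, contradicting
      properness.\<close>
    then have "smul (inverse c) 1 * smul c 1 \<in> I"
      using I unfolding is_ideal_def by blast
    then have "c = 0"
      using \<open>1 \<notin> I\<close> by (cases "c = 0") (simp_all flip: smul_mult_left)
    then show "a \<in> I'"
      using ci by simp
  qed
qed

section \<open>Algebra homomorphisms and cone faces\<close>

lemma algebra_hom_add: "algebra_hom s1 s2 f \<Longrightarrow> f (x + y) = f x + f y"
  and algebra_hom_scale: "algebra_hom s1 s2 f \<Longrightarrow> f (s1 c x) = s2 c (f x)"
  by (auto simp: algebra_hom_def Vector_Spaces.linear_iff)

lemma algebra_hom_0:
  assumes "algebra_hom s1 s2 f" shows "f 0 = 0"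
  using algebra_hom_add[OF assms, of 0 0] by simp

lemma algebra_hom_1: "algebra_hom s1 s2 f \<Longrightarrow> f 1 = 1"
  and algebra_hom_mult: "algebra_hom s1 s2 f \<Longrightarrow> f (x * y) = f x * f y"
  by (auto simp: algebra_hom_def)

lemma cone_face_0:
  assumes "convex_cone C" "cone_face C F" shows "0 \<in> F"
  using assms convex_cone_contains_0[of C] by (auto simp: cone_face_def)

section \<open>Application to the Laurent polynomial construction\<close>

theorem theorem2p3:
  fixes C :: "(real ^ 'n) set"
    and F :: "nat \<Rightarrow> (real ^ 'n) set"
    and r :: nat
    and smul :: "'k::field \<Rightarrow> 'r::idom \<Rightarrow> 'r"
    and I :: "'r set"
    and \<phi> :: "nat \<Rightarrow> 'r \<Rightarrow> ('k, 'n) laurent"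
    and U :: "('k, 'n) laurent set"
    and N :: nat
    and \<rho> :: "nat \<Rightarrow> 'r"
  assumes "convex_cone C"
    and "r \<ge> 2"
    and "\<And>i. i \<in> {1..r} \<Longrightarrow> cone_face C (F i)"
    and "\<And>i j. i \<in> {1..r} \<Longrightarrow> j \<in> {1..r} \<Longrightarrow> i \<noteq> j \<Longrightarrow> \<not> F i \<subseteq> F j"
    and "k_algebra smul"
    and "finitely_generated smul (UNIV :: 'r set)"
    and "is_ideal UNIV I"
    and "I \<noteq> {0}"
    and "range (\<lambda>c. smul c 1) + I = UNIV"
    and "\<And>i. i \<in> {1..r} \<Longrightarrow> algebra_hom smul laurent_scale (\<phi> i)"
    and "\<And>i. i \<in> {1..r} \<Longrightarrow> inj (\<phi> i)"
    and "\<And>i. i \<in> {1..r} \<Longrightarrow> real_vec ` supp_set (\<phi> i ` I) \<subseteq> face_interior r F i"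
    and "finite U"
    and "real_vec ` supp_set U \<subseteq> cone_interior r C F"
    and "N \<ge> 1"
    and "\<And>l. l \<in> {1..N} \<Longrightarrow> \<rho> l \<in> I - {0}"
    and "adjoin smul (\<rho> ` {1..N}) = UNIV"
  shows "finitely_generated laurent_scale (algebra_A r I \<phi> U N \<rho>)"
proof -
  interpret k_algebra smul by fact
  note I = assms(7) and hom = assms(10)
  \<comment> \<open>The geometry enters here: \<open>\<phi> 1\<close> sends 1 to the monomial with
    exponent 0, and the origin lies in every face, so also in \<open>F 2\<close>, which
    \<open>face_interior r F 1\<close> excludes. The second face exists because
    \<open>r \<ge> 2\<close>.\<close>
  have one: "1 \<notin> I"
  proof
    assume "1 \<in> I"
    have "1 \<in> {1..r}" "2 \<in> {1..r}"
      using \<open>r \<ge> 2\<close> by simp_all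
    have "1 \<in> \<phi> 1 ` I"
      using \<open>1 \<in> I\<close> algebra_hom_1[OF hom[OF \<open>1 \<in> {1..r}\<close>]] by (metis imageI)
    then have "0 \<in> supp_set (\<phi> 1 ` I)"
      unfolding supp_set_def by (intro UN_I[of 1]) simp_all
    then have "real_vec 0 \<in> face_interior r F 1"
      using assms(12)[OF \<open>1 \<in> {1..r}\<close>] by blast
    moreover have "real_vec 0 = (0 :: real ^ 'n)"
      by (simp add: real_vec_def vec_eq_iff)
    moreover have "0 \<in> F 2"
      using cone_face_0[OF assms(1) assms(3)[OF \<open>2 \<in> {1..r}\<close>]] .
    ultimately show False
      using \<open>2 \<in> {1..r}\<close> by (auto simp: face_interior_def)
  qed
  have \<rho>: "\<rho> ` {1..N} \<subseteq> I"
    using assms(16) by blast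
  have I_gen: "I = ideal_generated UNIV (\<rho> ` {1..N})"
    using I one \<rho> assms(17) by (rule proper_ideal_eq_ideal_generated)

  define X where "X = (\<Union>i\<in>{1..r}. \<phi> i ` \<rho> ` {1..N}) \<union> U"
  define B where "B = adjoin laurent_scale X"
  have B: "is_subalgebra laurent_scale B"
    unfolding B_def by (rule laurent.is_subalgebra_adjoin)
  have XB: "x \<in> B" if "x \<in> X" for x
    unfolding B_def using that by (rule laurent.adjoin_inc)
  have UB: "U \<subseteq> B"
    using XB by (auto simp: X_def)
  \<comment> \<open>The preimage of \<open>B\<close> under \<open>\<phi> i\<close> is a subalgebra
    containing the generators of \<open>R\<close>. Hence all of \<open>R\<close> maps into
    \<open>B\<close>, which also yields \<open>B_eq\<close>.\<close>
  have \<phi>B: "\<phi> i a \<in> B" if i: "i \<in> {1..r}" for i a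
  proof -
    have "is_subalgebra smul {a. \<phi> i a \<in> B}"
      by (rule is_subalgebraI)
        (simp_all add: algebra_hom_add[OF hom[OF i]] algebra_hom_mult[OF hom[OF i]]
          algebra_hom_scale[OF hom[OF i]] algebra_hom_1[OF hom[OF i]] laurent.subalgebra_add[OF B]
          laurent.subalgebra_mult[OF B] laurent.subalgebra_scale[OF B] laurent.subalgebra_1[OF B])
    then have "adjoin smul (\<rho> ` {1..N}) \<subseteq> {a. \<phi> i a \<in> B}"
    proof (rule adjoin_minimal)
      have "\<phi> i ` \<rho> ` {1..N} \<subseteq> X"
        unfolding X_def using i by blast
      then show "\<rho> ` {1..N} \<subseteq> {a. \<phi> i a \<in> B}"
        using XB by blast
    qed
    then show ?thesis
      using assms(17) by blast
  qed
  have B_eq: "algebra_B r I \<phi> U = B"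
  proof
    show "algebra_B r I \<phi> U \<subseteq> B"
      unfolding algebra_B_def
      by (rule laurent.adjoin_minimal[OF B]) (use \<phi>B UB in auto)
    show "B \<subseteq> algebra_B r I \<phi> U"
      unfolding algebra_B_def B_def
      by (intro laurent.adjoin_minimal laurent.is_subalgebra_adjoin)
        (use \<rho> in \<open>auto simp: X_def intro!: laurent.adjoin_inc\<close>)
  qed

  \<comment> \<open>The finite analogue of the generating set in \<open>ideal_J\<close>, with the
    generators of \<open>I\<close> in place of \<open>I\<close>.\<close>
  define G where "G = (\<Union>(i, j) \<in> {(i, j). 1 \<le> i \<and> i < j \<and> j \<le> r}.
    (\<phi> i ` \<rho> ` {1..N}) * (\<phi> j ` \<rho> ` {1..N})) \<union> U"
  define J where "J = ideal_generated B G"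
  have GB: "G \<subseteq> B"
    using UB by (auto simp: G_def elim!: set_times_elim intro!: laurent.subalgebra_mult[OF B] \<phi>B)
  have J: "is_ideal B J"
    unfolding J_def using laurent.is_ideal_self[OF B] GB by (rule is_ideal_ideal_generated)
  \<comment> \<open>The set of \<open>a\<close> with \<open>y * \<phi> i a \<in> J\<close> is an
    ideal of \<open>R\<close>, because \<open>\<phi> i\<close> maps \<open>R\<close> into
    \<open>B\<close>. By \<open>I_gen\<close> it contains \<open>I\<close> once it contains each
    \<open>\<rho> l\<close>.\<close>
  have ideal_vimage: "y * \<phi> i a \<in> J"
    if "i \<in> {1..r}" "a \<in> I" and gen: "\<And>l. l \<in> {1..N} \<Longrightarrow> y * \<phi> i (\<rho> l) \<in> J" for i a y
  proof -
    note hom_i = hom[OF that(1)]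
    have "is_ideal UNIV {a. y * \<phi> i a \<in> J}"
      using J \<phi>B[OF that(1)]
      by (simp add: is_ideal_def algebra_hom_add[OF hom_i] algebra_hom_mult[OF hom_i]
          algebra_hom_0[OF hom_i] distrib_left mult.left_commute[of y])
    then have "ideal_generated UNIV (\<rho> ` {1..N}) \<subseteq> {a. y * \<phi> i a \<in> J}"
      using gen by (intro ideal_generated_minimal) auto
    then show ?thesis
      using that(2) I_gen by blast
  qed
  \<comment> \<open>\<open>ideal_vimage\<close> is applied to one factor at a time: first
    \<open>b\<close> is reduced to a generator, then \<open>a\<close>.\<close>
  have \<phi>J_less: "\<phi> i a * \<phi> j b \<in> J" if ij: "i \<in> {1..r}" "j \<in> {1..r}" "i < j" and "a \<in> I" "b \<in> I" for i j a b
  proof (rule ideal_vimage[OF ij(2) \<open>b \<in> I\<close>])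
    fix m assume m: "m \<in> {1..N}"
    have "\<phi> j (\<rho> m) * \<phi> i a \<in> J"
    proof (rule ideal_vimage[OF ij(1) \<open>a \<in> I\<close>])
      fix l assume "l \<in> {1..N}"
      then have "\<phi> i (\<rho> l) * \<phi> j (\<rho> m) \<in> G"
        unfolding G_def using ij m by (intro UnI1 UN_I[of "(i, j)"]) auto
      then show "\<phi> j (\<rho> m) * \<phi> i (\<rho> l) \<in> J"
        unfolding J_def by (simp add: ideal_generated_inc mult.commute)
    qed
    then show "\<phi> i a * \<phi> j (\<rho> m) \<in> J"
      by (simp add: mult.commute)
  qed
  have \<phi>J: "\<phi> i a * \<phi> j b \<in> J" if "i \<in> {1..r}" "j \<in> {1..r}" "i \<noteq> j" "a \<in> I" "b \<in> I" for i j a b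
    using \<phi>J_less[of i j a b] \<phi>J_less[of j i b a] that by (cases i j rule: linorder_cases) (auto simp: mult.commute)
  have J_eq: "ideal_J r I \<phi> U = J"
  proof
    show "ideal_J r I \<phi> U \<subseteq> J"
      unfolding ideal_J_def B_eq
    proof (rule ideal_generated_minimal[OF _ J])
      have "U \<subseteq> J"
        by (auto simp: J_def G_def intro: ideal_generated_inc)
      then show "(\<Union>(i, j) \<in> {(i, j). 1 \<le> i \<and> i < j \<and> j \<le> r}. (\<phi> i ` I) * (\<phi> j ` I)) \<union> U \<subseteq> J"
        by (auto elim!: set_times_elim intro!: \<phi>J)
    qed
    have "\<phi> i ` \<rho> ` {1..N} \<subseteq> \<phi> i ` I" for i
      using \<rho> by (rule image_mono)
    then have "(\<phi> i ` \<rho> ` {1..N}) * (\<phi> j ` \<rho> ` {1..N}) \<subseteq> (\<phi> i ` I) * (\<phi> j ` I)" for i j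
      by (intro set_times_mono2)
    then have "G \<subseteq> (\<Union>(i, j) \<in> {(i, j). 1 \<le> i \<and> i < j \<and> j \<le> r}. (\<phi> i ` I) * (\<phi> j ` I)) \<union> U"
      unfolding G_def by (intro Un_mono UN_mono) auto
    then show "J \<subseteq> ideal_J r I \<phi> U"
      unfolding J_def ideal_J_def B_eq ideal_generated_def by (rule hull_mono)
  qed

  define \<sigma> where "\<sigma> l = (\<Sum>i=1..r. \<phi> i (\<rho> l))" for l
  have A_eq: "algebra_A r I \<phi> U N \<rho> = adjoin laurent_scale (\<sigma> ` {1..N}) + ideal_generated (adjoin laurent_scale X) G"
    unfolding algebra_A_def J_eq \<sigma>_def by (simp add: J_def B_def)
  have JA: "j \<in> adjoin laurent_scale (\<sigma> ` {1..N}) + ideal_generated (adjoin laurent_scale X) G" if "j \<in> J" for j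
    using set_plus_intro[OF laurent.subalgebra_0[OF laurent.is_subalgebra_adjoin] that]
    by (simp add: J_def B_def)
  show ?thesis
    unfolding A_eq
  proof (rule laurent.finitely_generated_adjoin_plus_ideal)
    show "finite X"
      using \<open>finite U\<close> by (simp add: X_def)
    have "finite {(i, j). 1 \<le> i \<and> i < j \<and> j \<le> r}"
      by (rule finite_subset[of _ "{1..r} \<times> {1..r}"]) auto
    then show "finite G"
      using \<open>finite U\<close> by (auto simp: G_def intro!: finite_set_times)
    show "\<sigma> ` {1..N} \<subseteq> adjoin laurent_scale X"
      using \<phi>B by (auto simp: \<sigma>_def B_def[symmetric] intro!: laurent.subalgebra_sum[OF B])
    show "G \<subseteq> adjoin laurent_scale X"
      using GB by (simp add: B_def)
  next
    let ?A = "adjoin laurent_scale (\<sigma> ` {1..N}) + ideal_generated (adjoin laurent_scale X) G"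
    have "0 \<in> J"
      using J by (simp add: is_ideal_def)
    fix x assume "x \<in> X"
    then consider i l where "i \<in> {1..r}" "l \<in> {1..N}" "x = \<phi> i (\<rho> l)" | "x \<in> U"
      by (auto simp: X_def)
    then show "\<exists>s\<in>?A. \<exists>t\<in>?A. x * x = s * x + t"
    proof cases
      case (1 i l)
      \<comment> \<open>The mixed terms of \<open>\<sigma> l * x\<close>; each is a product of
        images of \<open>I\<close> under two different maps, so \<open>\<phi>J\<close> places it in
        \<open>J\<close>.\<close>
      define t where "t = (\<Sum>j\<in>{1..r} - {i}. x * \<phi> j (\<rho> l))"
      have "t \<in> J"
        unfolding t_def using 1 \<rho> by (intro is_ideal_sum[OF J]) (auto intro!: \<phi>J)
      then have "- 1 * t \<in> J"
        using J laurent.subalgebra_uminus[OF B laurent.subalgebra_1[OF B]] unfolding is_ideal_def by blast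
      then have "- t \<in> J"
        by simp
      have "\<sigma> l = x + (\<Sum>j\<in>{1..r} - {i}. \<phi> j (\<rho> l))"
        using 1 by (simp add: \<sigma>_def sum.remove[of _ i])
      then have "\<sigma> l * x = x * x + t"
        by (simp add: t_def algebra_simps sum_distrib_left)
      then have "x * x = \<sigma> l * x + - t"
        by simp
      moreover have "\<sigma> l \<in> ?A"
        using set_plus_intro[OF laurent.adjoin_inc \<open>0 \<in> J\<close>, of "\<sigma> l" "\<sigma> ` {1..N}"] 1
        by (simp add: J_def B_def)
      ultimately show ?thesis
        using JA[OF \<open>- t \<in> J\<close>] by blast
    next
      \<comment> \<open>Elements of \<open>U\<close> already lie in \<open>J\<close>, so the trivial
        relation with coefficients \<open>x\<close> and 0 is available over
        \<open>?A\<close>.\<close>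
      case 2
      then have "x \<in> J"
        by (simp add: J_def G_def ideal_generated_inc)
      then show ?thesis
        using JA[of x] JA[OF \<open>0 \<in> J\<close>] by (intro bexI[of _ x] bexI[of _ 0]) simp_all
    qed
  qed simp
qed

end
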